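(* Let $(X,\to,0,1)$ be an implicative-orthomodular algebra. The following hold for all $x,y,z\in X$: (1) $(x\Cap y)\Cap y=x\Cap y$; (2) $x\Cup (y\Cap x)=x$; (3) $x\Cap (y\Cup x)=x$; (4) $x\Cap y\le_Q y\le_Q x\Cup y$; (5) $(x\Cap y)\Cap (y\Cap z)=(x\Cap y)\Cap z$; (6) $(x\Cup y)\Cup (y\Cup z)=(x\Cup y)\Cup z$; (7) $\le_Q$ is transitive; (8) $(x\to y)\Cup (x\to (z\Cap y))=x\to y$; (9) $(x\to y)\Cup ((z\to x)\to y)=x\to y$.
   Context: A BE algebra is an algebra $(X,\to,1)$ of type $(2,0)$ such that for all $x,y,z\in X$: $x\to x=1$; $x\to 1=1$; $1\to x=x$; $x\to(y\to z)=y\to(x\to z)$. Put $x\le y$ iff $x\to y=1$. It is bounded if there is $0\in X$ with $0\le x$ for all $x\in X$; then $x^*:=x\to 0$. It is involutive if it is bounded and $x^{**}=x$ for all $x$. In an involutive BE algebra $(X,\to,0,1)$ define $x\Cup y:=(x\to y)\to y$, $x\Cap y:=((x^*\to y^* )\to y^* )^*$, and $x\le_Q y$ iff $x=x\Cap y$. An implicative-orthomodular algebra is an involutive BE algebra satisfying $x\Cap(y\to x)=x$ for all $x,y\in X$. *)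

theory Defs
  imports Main
begin

record 'a be_structure =
  carrier :: "'a set"
  imp :: "'a \<Rightarrow> 'a \<Rightarrow> 'a"  (infixr "\<rightarrow>\<index>" 60)
  one :: "'a"  ("\<one>\<index>")

record 'a bounded_be_structure = "'a be_structure" +
  zero :: "'a"  ("\<zero>\<index>")

definition be_le :: "('a, 'b) be_structure_scheme \<Rightarrow> 'a \<Rightarrow> 'a \<Rightarrow> bool"  (infix "\<preceq>\<index>" 50)
  where "x \<preceq>\<^bsub>A\<^esub> y \<longleftrightarrow> (x \<rightarrow>\<^bsub>A\<^esub> y) = \<one>\<^bsub>A\<^esub>"

locale be_algebra =
  fixes A :: "('a, 'b) be_structure_scheme" (structure)
  assumes imp_closed: "\<lbrakk>x \<in> carrier A; y \<in> carrier A\<rbrakk> \<Longrightarrow> (x \<rightarrow> y) \<in> carrier A"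
    and one_closed: "\<one> \<in> carrier A"
    and imp_self: "x \<in> carrier A \<Longrightarrow> (x \<rightarrow> x) = \<one>"
    and imp_one: "x \<in> carrier A \<Longrightarrow> (x \<rightarrow> \<one>) = \<one>"
    and one_imp: "x \<in> carrier A \<Longrightarrow> (\<one> \<rightarrow> x) = x"
    and imp_exchange: "\<lbrakk>x \<in> carrier A; y \<in> carrier A; z \<in> carrier A\<rbrakk>
      \<Longrightarrow> (x \<rightarrow> (y \<rightarrow> z)) = (y \<rightarrow> (x \<rightarrow> z))"

text \<open>The relation \<open>\<preceq>\<close> need not be antisymmetric, so a least element is not determined by the
  remaining structure; the chosen \<open>\<zero>\<close> is therefore part of the signature of a bounded algebra.\<close>

locale bounded_be_algebra = be_algebra A
  for A :: "('a, 'b) bounded_be_structure_scheme" (structure) +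
  assumes zero_closed: "\<zero> \<in> carrier A"
    and zero_le: "x \<in> carrier A \<Longrightarrow> \<zero> \<preceq> x"

definition be_neg :: "('a, 'b) bounded_be_structure_scheme \<Rightarrow> 'a \<Rightarrow> 'a"  ("\<sim>\<index> _" [81] 80)
  where "\<sim>\<^bsub>A\<^esub> x = (x \<rightarrow>\<^bsub>A\<^esub> \<zero>\<^bsub>A\<^esub>)"

locale involutive_be_algebra = bounded_be_algebra A
  for A :: "('a, 'b) bounded_be_structure_scheme" (structure) +
  assumes neg_neg: "x \<in> carrier A \<Longrightarrow> \<sim> (\<sim> x) = x"

definition be_cup :: "('a, 'b) be_structure_scheme \<Rightarrow> 'a \<Rightarrow> 'a \<Rightarrow> 'a"  (infixl "\<squnion>\<index>" 65)
  where "x \<squnion>\<^bsub>A\<^esub> y = ((x \<rightarrow>\<^bsub>A\<^esub> y) \<rightarrow>\<^bsub>A\<^esub> y)"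

definition be_cap :: "('a, 'b) bounded_be_structure_scheme \<Rightarrow> 'a \<Rightarrow> 'a \<Rightarrow> 'a"  (infixl "\<sqinter>\<index>" 70)
  where "x \<sqinter>\<^bsub>A\<^esub> y = \<sim>\<^bsub>A\<^esub> ((\<sim>\<^bsub>A\<^esub> x \<rightarrow>\<^bsub>A\<^esub> \<sim>\<^bsub>A\<^esub> y) \<rightarrow>\<^bsub>A\<^esub> \<sim>\<^bsub>A\<^esub> y)"

definition be_leQ :: "('a, 'b) bounded_be_structure_scheme \<Rightarrow> 'a \<Rightarrow> 'a \<Rightarrow> bool"
    (infix "\<le>\<^sub>Q\<index>" 50)
  where "x \<le>\<^sub>Q\<^bsub>A\<^esub> y \<longleftrightarrow> x = x \<sqinter>\<^bsub>A\<^esub> y"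

locale implicative_orthomodular_algebra = involutive_be_algebra A
  for A :: "('a, 'b) bounded_be_structure_scheme" (structure) +
  assumes cap_imp: "\<lbrakk>x \<in> carrier A; y \<in> carrier A\<rbrakk> \<Longrightarrow> x \<sqinter> (y \<rightarrow> x) = x"

end

theory Submission
  imports Defs
begin

text \<open>Since \<open>x \<rightarrow> y = \<sim> y \<rightarrow> \<sim> x\<close>, an involutive BE algebra is a commutative monoid with an
  involution in disguise: the sum is \<open>\<sim> x \<rightarrow> y\<close>, and the exchange law is its associativity. The
  orthomodular axiom makes \<open>\<le>\<^sub>Q\<close> the divisibility preorder of this monoid: \<open>a \<le>\<^sub>Q b\<close> holds exactly
  when \<open>b = r \<rightarrow> a\<close> for some \<open>r\<close>, and then \<open>b\<close> absorbs \<open>a\<close> in the sense that \<open>b \<squnion> a = b\<close>.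

  Seen this way, exchange makes \<open>z \<rightarrow> _\<close> monotone, because \<open>z \<rightarrow> (r \<rightarrow> a) = r \<rightarrow> (z \<rightarrow> a)\<close>, and
  negation is antitone, because \<open>a = a \<sqinter> b\<close> exhibits \<open>\<sim> a\<close> as \<open>(b \<rightarrow> a) \<rightarrow> \<sim> b\<close>. Hence implication
  is antitone in its first argument, and the two identities of the form \<open>(x \<rightarrow> y) \<squnion> u = (x \<rightarrow> y)\<close>
  are absorption with \<open>u \<le>\<^sub>Q (x \<rightarrow> y)\<close>.

  The law for \<open>(x \<sqinter> y) \<sqinter> (y \<sqinter> z)\<close> depends on \<open>x \<sqinter> y\<close> only through \<open>x \<sqinter> y \<le>\<^sub>Q y\<close>: residuation
  and monotonicity give \<open>a \<sqinter> (y \<sqinter> z) = a \<sqinter> z\<close> for every \<open>a \<le>\<^sub>Q y\<close> (\<open>cap_cap_eq_of_leQ\<close>). If also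
  \<open>y \<le>\<^sub>Q z\<close>, this reads \<open>a \<sqinter> y = a \<sqinter> z\<close>, which is transitivity. The law for \<open>\<squnion>\<close> is its
  De Morgan dual.\<close>

context involutive_be_algebra
begin

lemma neg_closed: "x \<in> carrier A \<Longrightarrow> \<sim> x \<in> carrier A"
  by (simp add: be_neg_def imp_closed zero_closed)

lemma cup_closed: "x \<in> carrier A \<Longrightarrow> y \<in> carrier A \<Longrightarrow> x \<squnion> y \<in> carrier A"
  by (simp add: be_cup_def imp_closed)

lemma cap_closed: "x \<in> carrier A \<Longrightarrow> y \<in> carrier A \<Longrightarrow> x \<sqinter> y \<in> carrier A"
  by (simp add: be_cap_def imp_closed neg_closed)

lemmas closed = imp_closed neg_closed cup_closed cap_closed

text \<open>Exchange with \<open>\<zero>\<close> as the innermost term; involutivity then turns this into contraposition.\<close>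

lemma imp_neg_commute:
  assumes "x \<in> carrier A" "y \<in> carrier A"
  shows "(x \<rightarrow> \<sim> y) = (y \<rightarrow> \<sim> x)"
  using assms by (simp add: be_neg_def imp_exchange zero_closed)

lemma neg_imp_neg:
  assumes "x \<in> carrier A" "y \<in> carrier A"
  shows "(\<sim> x \<rightarrow> \<sim> y) = (y \<rightarrow> x)"
  using imp_neg_commute[of "\<sim> x" y] assms by (simp add: neg_neg neg_closed)

lemma neg_cap:
  assumes "x \<in> carrier A" "y \<in> carrier A"
  shows "\<sim> (x \<sqinter> y) = \<sim> x \<squnion> \<sim> y"
  using assms by (simp add: be_cap_def be_cup_def neg_neg closed)

lemma neg_cup:
  assumes "x \<in> carrier A" "y \<in> carrier A"
  shows "\<sim> (x \<squnion> y) = \<sim> x \<sqinter> \<sim> y"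
  using assms by (simp add: be_cap_def be_cup_def neg_neg closed)

text \<open>With the product \<open>a \<cdot> b = \<sim> (a \<rightarrow> \<sim> b)\<close>, the meet is \<open>y \<cdot> (y \<rightarrow> x)\<close>.\<close>

lemma cap_eq:
  assumes "x \<in> carrier A" "y \<in> carrier A"
  shows "x \<sqinter> y = \<sim> (y \<rightarrow> \<sim> (y \<rightarrow> x))"
  using assms by (simp add: be_cap_def neg_imp_neg[of x y] imp_neg_commute[of "y \<rightarrow> x" y] closed)

text \<open>Residuation for the product \<open>y \<sqinter> z = z \<cdot> (z \<rightarrow> y)\<close>.\<close>

lemma cap_imp_residual:
  assumes "y \<in> carrier A" "z \<in> carrier A" "a \<in> carrier A"
  shows "((y \<sqinter> z) \<rightarrow> a) = ((z \<rightarrow> y) \<rightarrow> (z \<rightarrow> a))"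
proof -
  have "((y \<sqinter> z) \<rightarrow> a) = (\<sim> a \<rightarrow> (z \<rightarrow> \<sim> (z \<rightarrow> y)))"
    using neg_imp_neg[of a "y \<sqinter> z"] assms by (simp add: cap_eq neg_neg closed)
  also have "\<dots> = (z \<rightarrow> (\<sim> a \<rightarrow> \<sim> (z \<rightarrow> y)))"
    using assms by (simp add: imp_exchange closed)
  also have "\<dots> = (z \<rightarrow> ((z \<rightarrow> y) \<rightarrow> a))"
    using assms by (simp add: neg_imp_neg closed)
  also have "\<dots> = ((z \<rightarrow> y) \<rightarrow> (z \<rightarrow> a))"
    using assms by (simp add: imp_exchange closed)
  finally show ?thesis .
qed

end

context implicative_orthomodular_algebra
begin

lemma cap_cup_absorb:
  assumes "x \<in> carrier A" "y \<in> carrier A"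
  shows "x \<sqinter> (y \<squnion> x) = x"
  using assms by (simp add: be_cup_def cap_imp closed)

lemma cup_cap_absorb:
  assumes "x \<in> carrier A" "y \<in> carrier A"
  shows "x \<squnion> (y \<sqinter> x) = x"
proof -
  have "\<sim> (\<sim> (x \<squnion> (y \<sqinter> x))) = \<sim> (\<sim> x \<sqinter> (\<sim> y \<squnion> \<sim> x))"
    using assms by (simp add: neg_cup neg_cap closed)
  then show ?thesis
    using assms by (simp add: cap_cup_absorb neg_neg closed)
qed

lemma leQ_imp_cup_eq:
  assumes "a \<in> carrier A" "b \<in> carrier A" "a \<le>\<^sub>Q b"
  shows "b \<squnion> a = b"
  using cup_cap_absorb[of b a] assms by (simp add: be_leQ_def)

lemma leQ_imp_self:
  assumes "a \<in> carrier A" "r \<in> carrier A"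
  shows "a \<le>\<^sub>Q (r \<rightarrow> a)"
  using assms by (simp add: be_leQ_def cap_imp)

text \<open>The divisibility description of \<open>\<le>\<^sub>Q\<close>. One direction is the orthomodular axiom; for the
  other, absorption supplies the witness \<open>r = b \<rightarrow> a\<close>.\<close>

lemma leQ_iff_ex_imp:
  assumes "a \<in> carrier A" "b \<in> carrier A"
  shows "a \<le>\<^sub>Q b \<longleftrightarrow> (\<exists>r\<in>carrier A. b = (r \<rightarrow> a))"
proof
  assume "a \<le>\<^sub>Q b"
  then have "b = ((b \<rightarrow> a) \<rightarrow> a)"
    using leQ_imp_cup_eq[of a b] assms by (simp add: be_cup_def)
  then show "\<exists>r\<in>carrier A. b = (r \<rightarrow> a)"
    using assms imp_closed by blast
next
  assume "\<exists>r\<in>carrier A. b = (r \<rightarrow> a)"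
  then show "a \<le>\<^sub>Q b"
    using assms leQ_imp_self by blast
qed

lemma imp_mono_leQ:
  assumes "a \<in> carrier A" "b \<in> carrier A" "z \<in> carrier A" "a \<le>\<^sub>Q b"
  shows "(z \<rightarrow> a) \<le>\<^sub>Q (z \<rightarrow> b)"
proof -
  obtain r where r: "r \<in> carrier A" "b = (r \<rightarrow> a)"
    using assms leQ_iff_ex_imp by blast
  then have "(z \<rightarrow> b) = (r \<rightarrow> (z \<rightarrow> a))"
    using assms by (simp add: imp_exchange)
  then show ?thesis
    using leQ_imp_self[of "z \<rightarrow> a" r] assms r by (simp add: closed)
qed

text \<open>A lower bound \<open>a = a \<sqinter> b\<close> is the product of \<open>b\<close> and \<open>b \<rightarrow> a\<close>, so its negation is an
  implication with conclusion \<open>\<sim> b\<close>.\<close>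

lemma neg_antimono_leQ:
  assumes "a \<in> carrier A" "b \<in> carrier A" "a \<le>\<^sub>Q b"
  shows "\<sim> b \<le>\<^sub>Q \<sim> a"
proof -
  have "\<sim> a = \<sim> (\<sim> (b \<rightarrow> \<sim> (b \<rightarrow> a)))"
    using assms cap_eq[of a b] by (simp add: be_leQ_def)
  also have "\<dots> = ((b \<rightarrow> a) \<rightarrow> \<sim> b)"
    using assms by (simp add: neg_neg imp_neg_commute[of b "b \<rightarrow> a"] closed)
  finally show ?thesis
    using leQ_imp_self[of "\<sim> b" "b \<rightarrow> a"] assms by (simp add: closed)
qed

lemma imp_antimono_leQ:
  assumes "a \<in> carrier A" "b \<in> carrier A" "z \<in> carrier A" "a \<le>\<^sub>Q b"
  shows "(b \<rightarrow> z) \<le>\<^sub>Q (a \<rightarrow> z)"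
  using imp_mono_leQ[of "\<sim> b" "\<sim> a" "\<sim> z"] neg_antimono_leQ[of a b] assms
  by (simp add: neg_imp_neg closed)

text \<open>Negation turns \<open>x \<sqinter> y\<close> into \<open>\<sim> x \<squnion> \<sim> y\<close>, an implication with conclusion \<open>\<sim> y\<close>; so
  \<open>\<sim> y \<le>\<^sub>Q \<sim> (x \<sqinter> y)\<close>, and negating once more reverses this.\<close>

lemma cap_leQ:
  assumes "x \<in> carrier A" "y \<in> carrier A"
  shows "x \<sqinter> y \<le>\<^sub>Q y"
proof -
  have "\<sim> y \<le>\<^sub>Q \<sim> (x \<sqinter> y)"
    using leQ_imp_self[of "\<sim> y" "\<sim> x \<rightarrow> \<sim> y"] assms by (simp add: neg_cap be_cup_def closed)
  from neg_antimono_leQ[OF _ _ this] show ?thesis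
    using assms by (simp add: neg_neg closed)
qed

lemma leQ_cup:
  assumes "x \<in> carrier A" "y \<in> carrier A"
  shows "y \<le>\<^sub>Q x \<squnion> y"
  using assms by (simp add: be_leQ_def cap_cup_absorb)

text \<open>Both sides are products with the factor \<open>z\<close>. Writing \<open>w = z \<rightarrow> y\<close> and \<open>q = z \<rightarrow> a\<close>,
  residuation gives \<open>a \<sqinter> (y \<sqinter> z) = z \<cdot> (w \<cdot> (w \<rightarrow> q)) = z \<cdot> (q \<sqinter> w)\<close>, whereas
  \<open>a \<sqinter> z = z \<cdot> q\<close>; monotonicity gives \<open>q \<sqinter> w = q\<close>.\<close>

lemma cap_cap_eq_of_leQ:
  assumes "a \<in> carrier A" "y \<in> carrier A" "z \<in> carrier A" "a \<le>\<^sub>Q y"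
  shows "a \<sqinter> (y \<sqinter> z) = a \<sqinter> z"
proof -
  define w where "w = (z \<rightarrow> y)"
  define q where "q = (z \<rightarrow> a)"
  have wq: "w \<in> carrier A" "q \<in> carrier A"
    using assms by (simp_all add: w_def q_def closed)
  have "q \<le>\<^sub>Q w"
    unfolding w_def q_def using assms by (intro imp_mono_leQ)
  then have "q = \<sim> (w \<rightarrow> \<sim> (w \<rightarrow> q))"
    using wq by (simp add: be_leQ_def flip: cap_eq)
  then have meet: "(w \<rightarrow> \<sim> (w \<rightarrow> q)) = \<sim> q"
    using wq by (metis neg_neg closed(1) closed(2))
  have "a \<sqinter> (y \<sqinter> z) = \<sim> ((y \<sqinter> z) \<rightarrow> \<sim> (w \<rightarrow> q))"
    using assms by (simp add: cap_eq[of a "y \<sqinter> z"] cap_imp_residual closed w_def q_def)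
  also have "((y \<sqinter> z) \<rightarrow> \<sim> (w \<rightarrow> q)) = (w \<rightarrow> (z \<rightarrow> \<sim> (w \<rightarrow> q)))"
    using assms wq by (simp add: cap_imp_residual closed flip: w_def)
  also have "\<dots> = (z \<rightarrow> (w \<rightarrow> \<sim> (w \<rightarrow> q)))"
    using assms wq by (simp add: imp_exchange closed)
  also have "\<dots> = (z \<rightarrow> \<sim> q)"
    by (simp add: meet)
  also have "\<sim> (z \<rightarrow> \<sim> q) = a \<sqinter> z"
    using assms by (simp add: cap_eq q_def)
  finally show ?thesis .
qed

lemma cap_cap_cap:
  assumes "x \<in> carrier A" "y \<in> carrier A" "z \<in> carrier A"
  shows "(x \<sqinter> y) \<sqinter> (y \<sqinter> z) = (x \<sqinter> y) \<sqinter> z"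
  using assms by (intro cap_cap_eq_of_leQ cap_leQ closed)

lemma cup_cup_cup:
  assumes "x \<in> carrier A" "y \<in> carrier A" "z \<in> carrier A"
  shows "(x \<squnion> y) \<squnion> (y \<squnion> z) = (x \<squnion> y) \<squnion> z"
proof -
  have "\<sim> ((x \<squnion> y) \<squnion> (y \<squnion> z)) = \<sim> ((x \<squnion> y) \<squnion> z)"
    using assms by (simp add: neg_cup cap_cap_cap closed)
  then show ?thesis
    using assms by (metis neg_neg cup_closed)
qed

lemma leQ_trans:
  assumes "a \<in> carrier A" "b \<in> carrier A" "c \<in> carrier A" "a \<le>\<^sub>Q b" "b \<le>\<^sub>Q c"
  shows "a \<le>\<^sub>Q c"
  using cap_cap_eq_of_leQ[of a b c] assms by (simp add: be_leQ_def)

lemma imp_cup_imp_cap: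
  assumes "x \<in> carrier A" "y \<in> carrier A" "z \<in> carrier A"
  shows "(x \<rightarrow> y) \<squnion> (x \<rightarrow> (z \<sqinter> y)) = (x \<rightarrow> y)"
  using assms by (intro leQ_imp_cup_eq imp_mono_leQ cap_leQ closed)

lemma imp_cup_imp_imp:
  assumes "x \<in> carrier A" "y \<in> carrier A" "z \<in> carrier A"
  shows "(x \<rightarrow> y) \<squnion> ((z \<rightarrow> x) \<rightarrow> y) = (x \<rightarrow> y)"
  using assms by (intro leQ_imp_cup_eq imp_antimono_leQ leQ_imp_self closed)

end

theorem proposition3p8:
  fixes A :: "('a, 'b) bounded_be_structure_scheme" (structure)
  assumes "implicative_orthomodular_algebra A"
    and "x \<in> carrier A" and "y \<in> carrier A" and "z \<in> carrier A"
  shows "((x \<sqinter> y) \<sqinter> y = x \<sqinter> y)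
    \<and> (x \<squnion> (y \<sqinter> x) = x)
    \<and> (x \<sqinter> (y \<squnion> x) = x)
    \<and> ((x \<sqinter> y) \<le>\<^sub>Q y \<and> y \<le>\<^sub>Q (x \<squnion> y))
    \<and> ((x \<sqinter> y) \<sqinter> (y \<sqinter> z) = (x \<sqinter> y) \<sqinter> z)
    \<and> ((x \<squnion> y) \<squnion> (y \<squnion> z) = (x \<squnion> y) \<squnion> z)
    \<and> transp_on (carrier A) (be_leQ A)
    \<and> ((x \<rightarrow> y) \<squnion> (x \<rightarrow> (z \<sqinter> y)) = (x \<rightarrow> y))
    \<and> ((x \<rightarrow> y) \<squnion> ((z \<rightarrow> x) \<rightarrow> y) = (x \<rightarrow> y))"
proof -
  interpret implicative_orthomodular_algebra A by (rule assms(1))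
  note c = assms(2-4)
  have "(x \<sqinter> y) \<sqinter> y = x \<sqinter> y"
    using cap_leQ[of x y] c by (simp add: be_leQ_def)
  moreover have "transp_on (carrier A) (be_leQ A)"
    by (intro transp_onI) (rule leQ_trans)
  ultimately show ?thesis
    using c by (simp add: cup_cap_absorb cap_cup_absorb cap_leQ leQ_cup cap_cap_cap cup_cup_cup
      imp_cup_imp_cap imp_cup_imp_imp)
qed

end
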